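(* Let $p$ be a prime, $m\ge 1$, and $e_1\ge e_2\ge\cdots\ge e_m\ge 1$ integers, and let $G=\bigoplus_{j=1}^m\mathbb{Z}_{p^{e_j}}$, so $|G|=\prod_{j=1}^m p^{e_j}$. For every sequence $(g_k)_{k=1}^{|G|}$ of $|G|$ elements of $G$ there is a nonempty subsequence $(g_k)_{k\in K}$ (with $\emptyset\neq K\subseteq\{1,\dots,|G|\}$) such that $\sum_{k\in K}g_k=0_G$ and $\sum_{k\in K}1/|g_k|\le 1$.
   Context: $\mathbb{Z}_n$ denotes the cyclic group of order $n$; $|g|$ denotes the order of an element $g\in G$ and $0_G$ the identity of $G$. Sequences may contain repeated elements. *)

theory Defs
  imports Complex_Main "HOL-Algebra.Product_Groups" "HOL-Algebra.Multiplicative_Group"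
    "HOL-Computational_Algebra.Primes"
begin

end

theory Submission
  imports Defs "HOL-Library.Disjoint_Sets"
begin

text \<open>
  The cyclic subgroups of an abelian \<open>p\<close>-group form a tree rooted at the trivial subgroup, in which
  the parent of a subgroup of order \<open>p ^ Suc k\<close> is its subgroup of order \<open>p ^ k\<close>. Regard an index set
  \<open>K\<close> whose product lies in \<open>C\<close> and whose cross number is at most \<open>1 / card C\<close> as a pebble on
  \<open>C\<close>; every term of the sequence is a pebble on the subgroup that it generates. Among \<open>p\<close> disjoint
  pebbles on the same vertex some nonempty subfamily has its product in the parent, and its cross
  number is at most \<open>p\<close> times larger, so \<open>p\<close> pebbles on a vertex can be traded for one on the
  parent. If no pebble reaches the root, then the losses \<open>s mod p\<close> at the vertices account for the
  whole sequence. Cutting the tree into chains, a chain of \<open>l\<close> vertices absorbs at most \<open>p ^ l - 1\<close>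
  terms, while its vertices have at least \<open>p ^ l - 1\<close> generators in total. As every element of the
  group other than the identity generates exactly one vertex, the sequence has at most
  \<open>order G - 1\<close> terms. Instead of cutting into chains, the induction over the tree below uses a
  superadditive bound on the number of terms above a vertex that is left with \<open>s\<close> pebbles.
\<close>

section \<open>Cyclic subgroups of prime power order\<close>

context group
begin

lemma subgroup_pow_card_eq_one:
  assumes "subgroup H G" "x \<in> H"
  shows "x [^] card H = \<one>"
proof -
  interpret H: group "G\<lparr>carrier := H\<rparr>"
    using assms(1) by (rule subgroup_imp_group)
  have "x [^]\<^bsub>G\<lparr>carrier := H\<rparr>\<^esub> card H = \<one>"
    using H.pow_order_eq_1[of x] assms(2) by (simp add: order_def)
  then show ?thesis
    by (simp add: nat_pow_consistent[symmetric])
qed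

text \<open>The elements killed by \<open>p ^ k\<close> are exactly the powers of
  \<open>x [^] (p ^ (a - k))\<close>, which has order \<open>p ^ k\<close>.\<close>

lemma subgroup_cyclic_prime_power:
  assumes p: "Factorial_Ring.prime p"
    and x: "x \<in> carrier G" "ord x = p ^ a" and "k \<le> a"
  shows "subgroup {y \<in> generate G {x}. y [^] (p ^ k) = \<one>} G"
    and "card {y \<in> generate G {x}. y [^] (p ^ k) = \<one>} = p ^ k"
proof -
  have p0: "p > 0"
    using p prime_gt_0_nat by blast
  let ?z = "x [^] (p ^ (a - k))"
  have z: "?z \<in> carrier G"
    using x by simp
  have split: "p ^ a = p ^ (a - k) * p ^ k"
    using \<open>k \<le> a\<close> by (simp flip: power_add)
  have ordz: "ord ?z = p ^ k"
  proof -
    have "ord ?z = ord x div p ^ (a - k)"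
      using x p0 by (intro ord_pow) (auto simp: split)
    then show ?thesis
      using x p0 by (simp add: split)
  qed
  have subz: "subgroup (generate G {?z}) G"
    using z by (simp add: generate_is_subgroup)
  have eq: "{y \<in> generate G {x}. y [^] (p ^ k) = \<one>} = generate G {?z}"
  proof
    show "{y \<in> generate G {x}. y [^] (p ^ k) = \<one>} \<subseteq> generate G {?z}"
    proof
      fix y assume "y \<in> {y \<in> generate G {x}. y [^] (p ^ k) = \<one>}"
      then obtain i :: nat where i: "y = x [^] i" "y [^] (p ^ k) = \<one>"
        using generate_pow_nat[OF x(1)] x(2) p0 by auto
      then have "x [^] (i * p ^ k) = \<one>"
        using x by (simp add: nat_pow_pow)
      then have "p ^ (a - k) * p ^ k dvd i * p ^ k"
        using x split by (simp add: pow_eq_id)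
      then have "p ^ (a - k) dvd i"
        using p0 by simp
      then obtain j where "i = p ^ (a - k) * j" ..
      then have "y = ?z [^] j"
        using i x by (simp add: nat_pow_pow)
      then show "y \<in> generate G {?z}"
        using generate_pow_nat[OF z] ordz p0 by auto
    qed
    show "generate G {?z} \<subseteq> {y \<in> generate G {x}. y [^] (p ^ k) = \<one>}"
    proof
      fix y assume y: "y \<in> generate G {?z}"
      have "?z \<in> generate G {x}"
        using generate_pow_nat[OF x(1)] x(2) p0 by auto
      then have "generate G {?z} \<subseteq> generate G {x}"
        using x by (intro generate_subgroup_incl generate_is_subgroup) auto
      moreover have "y [^] (p ^ k) = \<one>"
        using subgroup_pow_card_eq_one[OF subz y] generate_pow_card[OF z] ordz by simp
      ultimately show "y \<in> {y \<in> generate G {x}. y [^] (p ^ k) = \<one>}"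
        using y by blast
    qed
  qed
  show "subgroup {y \<in> generate G {x}. y [^] (p ^ k) = \<one>} G"
    using subz unfolding eq .
  show "card {y \<in> generate G {x}. y [^] (p ^ k) = \<one>} = p ^ k"
    using generate_pow_card[OF z] ordz unfolding eq by simp
qed

text \<open>By Lagrange \<open>H\<close> consists of elements killed by \<open>p ^ k\<close>, and
  there are only \<open>p ^ k\<close> of these. This uniqueness is what makes the cyclic subgroups a
  tree.\<close>

lemma subgroup_cyclic_prime_power_unique:
  assumes p: "Factorial_Ring.prime p"
    and x: "x \<in> carrier G" "ord x = p ^ a"
    and H: "subgroup H G" "H \<subseteq> generate G {x}" "card H = p ^ k"
  shows "k \<le> a" and "H = {y \<in> generate G {x}. y [^] (p ^ k) = \<one>}"
proof -
  have p1: "p > 1"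
    using p prime_gt_1_nat by blast
  have card_x: "card (generate G {x}) = p ^ a"
    using generate_pow_card[OF x(1)] x(2) by simp
  then have fin: "finite (generate G {x})"
    using p1 by (intro card_ge_0_finite) simp
  have "p ^ k \<le> p ^ a"
    using card_mono[OF fin H(2)] H(3) card_x by simp
  then show le: "k \<le> a"
    using p1 power_increasing_iff by blast
  show "H = {y \<in> generate G {x}. y [^] (p ^ k) = \<one>}"
  proof (rule card_seteq)
    show "H \<subseteq> {y \<in> generate G {x}. y [^] (p ^ k) = \<one>}"
      using H subgroup_pow_card_eq_one[OF H(1)] by auto
  qed (use fin H(3) subgroup_cyclic_prime_power(2)[OF p x le] in auto)
qed

end

section \<open>Short zero-sum subsets modulo a subgroup\<close>

lemma (in comm_group) finprod_subgroup_closed: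
  assumes "subgroup H G" "f \<in> A \<rightarrow> H"
  shows "finprod G f A \<in> H"
  using assms(2)
proof (induction A rule: infinite_finite_induct)
  case (insert a A)
  then have "f \<in> A \<rightarrow> carrier G" "f a \<in> carrier G"
    using subgroup.mem_carrier[OF assms(1)] by auto
  then show ?case
    using insert subgroup.m_closed[OF assms(1)] by auto
qed (use subgroup.one_closed[OF assms(1)] in auto)

text \<open>Pigeonhole for the products of initial segments, modulo \<open>C\<close>.\<close>

lemma (in comm_group) exists_subset_finprod_in_subgroup:
  assumes C: "subgroup C G" and D: "subgroup D G" and "C \<subseteq> D" and "finite D"
    and "finite Q" and f: "f \<in> Q \<rightarrow> D" and card: "card D < (card Q + 1) * card C"
  shows "\<exists>R \<subseteq> Q. R \<noteq> {} \<and> finprod G f R \<in> C"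
proof -
  obtain b where b: "bij_betw b {..<card Q} Q"
    using ex_bij_betw_nat_finite[OF \<open>finite Q\<close>] by (auto simp: atLeast0LessThan)
  define P where "P j = finprod G f (b ` {..<j})" for j
  have bQ: "b ` A \<subseteq> Q" if "A \<subseteq> {..<card Q}" for A
    using that b by (auto simp: bij_betw_def)
  have fA: "f \<in> A \<rightarrow> carrier G" if "A \<subseteq> Q" for A
    using that f subgroup.mem_carrier[OF D] by auto
  have PD: "P j \<in> D" if "j \<le> card Q" for j
    unfolding P_def by (rule finprod_subgroup_closed[OF D]) (use that f bQ[of "{..<j}"] in auto)
  \<comment> \<open>A collision of \<open>?h\<close> says that two prefix products lie in the same
    coset of \<open>C\<close>, without forming the quotient.\<close>
  let ?h = "\<lambda>(j, c). c \<otimes> P j"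
  have "?h ` ({..card Q} \<times> C) \<subseteq> D"
    using PD \<open>C \<subseteq> D\<close> subgroup.m_closed[OF D] by auto
  then have "\<not> inj_on ?h ({..card Q} \<times> C)"
    using card_inj_on_le[of ?h "{..card Q} \<times> C" D] \<open>finite D\<close> card
    by (auto simp: card_cartesian_product)
  then obtain i c j d where ij: "i \<le> card Q" "j \<le> card Q" "c \<in> C" "d \<in> C"
    "(i, c) \<noteq> (j, d)" "c \<otimes> P i = d \<otimes> P j"
    unfolding inj_on_def by auto
  have carr: "c \<in> carrier G" "d \<in> carrier G" "P i \<in> carrier G" "P j \<in> carrier G"
    using ij PD subgroup.mem_carrier[OF C] subgroup.mem_carrier[OF D] by auto
  have main: "\<exists>R \<subseteq> Q. R \<noteq> {} \<and> finprod G f R \<in> C"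
    if ij: "i < j" "j \<le> card Q" "c \<in> C" "d \<in> C" "c \<otimes> P i = d \<otimes> P j"
      and carr: "c \<in> carrier G" "d \<in> carrier G" "P i \<in> carrier G" "P j \<in> carrier G" for i j c d
  proof (intro exI conjI)
    let ?R = "b ` {i..<j}"
    show RQ: "?R \<subseteq> Q"
      using ij by (intro bQ) auto
    show "?R \<noteq> {}"
      using ij by auto
    have R: "finprod G f ?R \<in> carrier G"
      using fA[OF RQ] by simp
    have "b ` {..<j} = b ` {..<i} \<union> ?R"
      using ij(1) by (metis image_Un ivl_disj_un_one(2) less_imp_le)
    moreover have "b ` {..<i} \<inter> ?R = {}"
    proof -
      have "inj_on b {..<card Q}"
        using b by (simp add: bij_betw_def)
      then have "b ` ({..<i} \<inter> {i..<j}) = b ` {..<i} \<inter> ?R"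
        using ij by (intro inj_on_image_Int) auto
      then show ?thesis
        by auto
    qed
    ultimately have "P j = P i \<otimes> finprod G f ?R"
      unfolding P_def using fA[OF RQ] fA[OF bQ[of "{..<i}"]] ij
      by (simp add: finprod_Un_disjoint)
    then have "P i \<otimes> c = P i \<otimes> (d \<otimes> finprod G f ?R)"
      using ij carr R by (simp add: m_ac)
    then have "c = d \<otimes> finprod G f ?R"
      using carr R by simp
    then have "finprod G f ?R = inv d \<otimes> c"
      using carr R by (simp add: inv_solve_left)
    then show "finprod G f ?R \<in> C"
      using ij subgroup.m_closed[OF C] subgroup.m_inv_closed[OF C] by simp
  qed
  consider "i < j" | "j < i" | "i = j" "c \<noteq> d"
    using ij by fastforce
  then show ?thesis
  proof cases
    case 1
    then show ?thesis using main ij carr by metis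
  next
    case 2
    then show ?thesis using main[of j i d c] ij carr by metis
  next
    case 3
    then show ?thesis using ij carr by simp
  qed
qed

section \<open>Packings\<close>

text \<open>A packing of size \<open>s\<close> is a configuration of \<open>s\<close> pebbles on the vertex \<open>C\<close>.\<close>

definition (in comm_group) packs :: "('i \<Rightarrow> 'a) \<Rightarrow> 'a set \<Rightarrow> 'i set \<Rightarrow> nat \<Rightarrow> bool" where
  "packs g C I s \<longleftrightarrow> (\<exists>P. finite P \<and> card P = s \<and> pairwise disjnt P \<and>
     (\<forall>K\<in>P. K \<noteq> {} \<and> K \<subseteq> I \<and> finprod G g K \<in> C \<and>
        (\<Sum>k\<in>K. 1 / real (ord (g k))) \<le> 1 / real (card C)))"

context comm_group
begin

lemma packs_0: "packs g C I 0"
  unfolding packs_def by (rule exI[of _ "{}"]) auto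

lemma packs_mono: "packs g C I s \<Longrightarrow> I \<subseteq> J \<Longrightarrow> packs g C J s"
  unfolding packs_def by (erule ex_forward) blast

lemma packs_Un:
  assumes "packs g C I s" "packs g C J t" "I \<inter> J = {}"
  shows "packs g C (I \<union> J) (s + t)"
proof -
  obtain P where P: "finite P" "card P = s" "pairwise disjnt P"
    "\<forall>K\<in>P. K \<noteq> {} \<and> K \<subseteq> I \<and> finprod G g K \<in> C \<and>
        (\<Sum>k\<in>K. 1 / real (ord (g k))) \<le> 1 / real (card C)"
    using assms(1) unfolding packs_def by blast
  obtain Q where Q: "finite Q" "card Q = t" "pairwise disjnt Q"
    "\<forall>K\<in>Q. K \<noteq> {} \<and> K \<subseteq> J \<and> finprod G g K \<in> C \<and>
        (\<Sum>k\<in>K. 1 / real (ord (g k))) \<le> 1 / real (card C)"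
    using assms(2) unfolding packs_def by blast
  have disj: "disjnt K L" if "K \<in> P" "L \<in> Q" for K L
  proof -
    have "K \<subseteq> I" "L \<subseteq> J"
      using that P(4) Q(4) by simp_all
    then show ?thesis
      using assms(3) unfolding disjnt_def by blast
  qed
  \<comment> \<open>A common block would be disjoint from itself and hence empty, which packings
    exclude; so the sizes add.\<close>
  have "P \<inter> Q = {}"
  proof (rule equals0I)
    fix K assume "K \<in> P \<inter> Q"
    then have "disjnt K K" "K \<noteq> {}"
      using disj[of K K] P(4) by blast+
    then show False
      by (simp add: disjnt_def)
  qed
  then have "card (P \<union> Q) = s + t"
    using P Q by (simp add: card_Un_disjoint)
  moreover have "pairwise disjnt (P \<union> Q)"
    using P(3) Q(3) disj unfolding pairwise_def by (metis Un_iff disjnt_sym)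
  moreover have "\<forall>K\<in>P \<union> Q. K \<noteq> {} \<and> K \<subseteq> I \<union> J \<and> finprod G g K \<in> C \<and>
        (\<Sum>k\<in>K. 1 / real (ord (g k))) \<le> 1 / real (card C)"
    using P(4) Q(4) by (simp add: ball_Un le_supI1 le_supI2)
  moreover have "finite (P \<union> Q)"
    using P(1) Q(1) by simp
  ultimately show ?thesis
    unfolding packs_def by (intro exI[of _ "P \<union> Q"] conjI)
qed

lemma packs_UN:
  assumes "finite A" "\<And>a. a \<in> A \<Longrightarrow> packs g C (I a) (s a)" "disjoint_family_on I A"
  shows "packs g C (\<Union>a\<in>A. I a) (\<Sum>a\<in>A. s a)"
  using assms
proof (induction A rule: finite_induct)
  case (insert a A)
  then have "I a \<inter> (\<Union>a\<in>A. I a) = {}"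
    by (auto simp: disjoint_family_on_def)
  moreover have "packs g C (\<Union>a\<in>A. I a) (\<Sum>a\<in>A. s a)"
    using insert by (auto simp: disjoint_family_on_def)
  ultimately show ?case
    using insert packs_Un[of g C "I a" "s a"] by simp
qed (simp add: packs_0)

text \<open>A single term attains the cross number bound with equality, because the subgroup it
  generates has \<open>ord (g i)\<close> elements. These are the initial pebbles.\<close>

lemma packs_singletons:
  assumes "finite I" "\<And>i. i \<in> I \<Longrightarrow> g i \<in> carrier G \<and> generate G {g i} = C"
  shows "packs g C I (card I)"
  unfolding packs_def
proof (intro exI conjI ballI)
  show "card ((\<lambda>i. {i}) ` I) = card I"
    by (simp add: card_image)
  show "pairwise disjnt ((\<lambda>i. {i}) ` I)"
    by (auto simp: pairwise_def)
  fix K assume "K \<in> (\<lambda>i. {i}) ` I"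
  then obtain i where i: "K = {i}" "i \<in> I" by blast
  show "finprod G g K \<in> C"
    using i assms(2)[OF i(2)] generate.incl[of "g i" "{g i}" G] by auto
  show "(\<Sum>k\<in>K. 1 / real (ord (g k))) \<le> 1 / real (card C)"
    using i assms(2)[OF i(2)] generate_pow_card[of "g i"] by auto
qed (use assms in auto)

text \<open>Pigeonhole yields a union of at most \<open>p\<close> blocks with product in
  \<open>C\<close>, and its cross number is at most \<open>p / card D = 1 / card C\<close>. Hence
  \<open>p\<close> pebbles on \<open>D\<close> buy one on \<open>C\<close>.\<close>

lemma packs_subgroup_step:
  assumes C: "subgroup C G" and D: "subgroup D G" and "C \<subseteq> D" "finite D"
    and card: "card D = p * card C"
    and g: "g \<in> I \<rightarrow> carrier G" and "finite I"
    and packs: "packs g D I s"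
  shows "packs g C I (s div p)"
proof -
  have posC: "card C > 0"
    using subgroup.one_closed[OF C] \<open>C \<subseteq> D\<close> \<open>finite D\<close> card_gt_0_iff finite_subset by blast
  have posD: "card D > 0"
    using subgroup.one_closed[OF D] \<open>finite D\<close> card_gt_0_iff by blast
  have p: "p > 0"
    using posD card by (cases p) auto
  have merge: "packs g C (\<Union>P) q"
    if "finite P" "pairwise disjnt P" "p * q \<le> card P"
      "\<forall>K\<in>P. K \<noteq> {} \<and> K \<subseteq> I \<and> finprod G g K \<in> D \<and>
        (\<Sum>k\<in>K. 1 / real (ord (g k))) \<le> 1 / real (card D)" for P q
    using that
  proof (induction q arbitrary: P)
    case 0
    then show ?case by (simp add: packs_0)
  next
    case (Suc q)
    obtain Q where Q: "Q \<subseteq> P" "card Q = p"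
      using Suc.prems(3) obtain_subset_with_card_n[of p P] by auto
    then have finQ: "finite Q"
      using Suc.prems(1) finite_subset by blast
    \<comment> \<open>The empty prefix makes \<open>p\<close> blocks enough:
      \<open>(p + 1) * card C\<close> exceeds \<open>card D = p * card C\<close>.\<close>
    have "card D < (card Q + 1) * card C"
      using card posC Q by simp
    then obtain R where R: "R \<subseteq> Q" "R \<noteq> {}" "finprod G (finprod G g) R \<in> C"
      using exists_subset_finprod_in_subgroup[OF C D \<open>C \<subseteq> D\<close> \<open>finite D\<close> finQ, of "finprod G g"]
        Q Suc.prems(4) by blast
    have finR: "finite R"
      using R finQ finite_subset by blast
    have RP: "R \<subseteq> P" using R Q by blast
    have pwR: "pairwise disjnt R"
      using Suc.prems(2) RP pairwise_subset by blast
    have KI: "finite K" "K \<subseteq> I" if "K \<in> P" for K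
      using that Suc.prems(4) \<open>finite I\<close> finite_subset by blast+
    have fp: "finprod G g (\<Union>R) = finprod G (finprod G g) R"
      using finR pwR KI RP g by (intro finprod_Union_disjoint) blast+
    have "(\<Sum>k\<in>\<Union>R. 1 / real (ord (g k))) = (\<Sum>K\<in>R. \<Sum>k\<in>K. 1 / real (ord (g k)))"
      using pwR KI RP by (subst sum.Union_disjoint) (auto simp: pairwise_def disjnt_def)
    also have "\<dots> \<le> (\<Sum>K\<in>R. 1 / real (card D))"
      using RP Suc.prems(4) by (intro sum_mono) blast
    also have "\<dots> = real (card R) / real (card D)"
      by simp
    also have "\<dots> \<le> real p / real (card D)"
      using card_mono[OF finQ R(1)] Q by (intro divide_right_mono) auto
    also have "\<dots> = 1 / real (card C)"
      using card p by simp
    finally have cross: "(\<Sum>k\<in>\<Union>R. 1 / real (ord (g k))) \<le> 1 / real (card C)" .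
    \<comment> \<open>The merged block comes from \<open>R\<close> alone, but all of
      \<open>Q\<close> is spent, so each round costs exactly \<open>p\<close> blocks.\<close>
    have one: "packs g C (\<Union>Q) 1"
      unfolding packs_def
    proof (intro exI conjI ballI)
      show "card {\<Union>R} = 1" by simp
      fix K assume "K \<in> {\<Union>R}"
      then have K: "K = \<Union>R" by simp
      show "K \<noteq> {}"
        using K R RP Suc.prems(4) by blast
      show "K \<subseteq> \<Union>Q"
        using K R by blast
      show "finprod G g K \<in> C" using K fp R by simp
      show "(\<Sum>k\<in>K. 1 / real (ord (g k))) \<le> 1 / real (card C)"
        using K cross by simp
    qed auto
    have rest: "packs g C (\<Union>(P - Q)) q"
    proof (rule Suc.IH)
      show "finite (P - Q)" using Suc.prems(1) by simp
      show "pairwise disjnt (P - Q)"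
        using Suc.prems(2) pairwise_subset by blast
      show "p * q \<le> card (P - Q)"
        using Suc.prems(3) Q finQ by (simp add: card_Diff_subset)
    qed (use Suc.prems(4) in blast)
    have "\<Union>Q \<inter> \<Union>(P - Q) = {}"
    proof -
      have "K \<inter> L = {}" if "K \<in> Q" "L \<in> P - Q" for K L
        using that Q(1) pairwiseD[OF Suc.prems(2), of K L] by (auto simp: disjnt_def)
      then show ?thesis
        by blast
    qed
    from packs_Un[OF one rest this] have "packs g C (\<Union>Q \<union> \<Union>(P - Q)) (Suc q)"
      by simp
    then show ?case
      by (rule packs_mono) (use Q in blast)
  qed
  obtain P where P: "finite P" "card P = s" "pairwise disjnt P"
    "\<forall>K\<in>P. K \<noteq> {} \<and> K \<subseteq> I \<and> finprod G g K \<in> D \<and>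
        (\<Sum>k\<in>K. 1 / real (ord (g k))) \<le> 1 / real (card D)"
    using packs unfolding packs_def by blast
  have "packs g C (\<Union>P) (s div p)"
    by (rule merge) (use P in auto)
  then show ?thesis
    by (rule packs_mono) (use P(4) in blast)
qed

end

section \<open>Counting\<close>

text \<open>
  The truncated subtraction makes this the convex piecewise linear function that has slope 1 up to
  \<open>p ^ k - 1\<close> and slope \<open>p ^ (N - k)\<close> from there on.
\<close>

definition pebble_bound :: "nat \<Rightarrow> nat \<Rightarrow> nat \<Rightarrow> nat \<Rightarrow> nat" where
  "pebble_bound p N k s = s + (p ^ (N - k) - 1) * (s - (p ^ k - 1))"

lemma pebble_bound_ge: "s \<le> pebble_bound p N k s"
  by (simp add: pebble_bound_def)

text \<open>Beyond the linear part, the left side pays the threshold \<open>p ^ k - 1\<close> twice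
  and the right side only once.\<close>

lemma pebble_bound_superadditive:
  "pebble_bound p N k s + pebble_bound p N k t \<le> pebble_bound p N k (s + t)"
proof -
  have "(s - (p ^ k - 1)) + (t - (p ^ k - 1)) \<le> s + t - (p ^ k - 1)"
    by simp
  then have "(p ^ (N - k) - 1) * ((s - (p ^ k - 1)) + (t - (p ^ k - 1)))
    \<le> (p ^ (N - k) - 1) * (s + t - (p ^ k - 1))"
    by (rule mult_le_mono2)
  then show ?thesis
    by (simp add: pebble_bound_def add_mult_distrib2)
qed

lemma pebble_bound_sum:
  "finite A \<Longrightarrow> (\<Sum>a\<in>A. pebble_bound p N k (s a)) \<le> pebble_bound p N k (\<Sum>a\<in>A. s a)"
proof (induction A rule: finite_induct)
  case (insert a A)
  then show ?case
    using pebble_bound_superadditive[of p N k "s a" "\<Sum>a\<in>A. s a"] by simp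
qed simp

text \<open>A cyclic subgroup of order \<open>p ^ Suc k\<close> has \<open>p ^ Suc k - p ^ k\<close>
  generators, and they pay for the remainder lost when \<open>s\<close> pebbles move to the parent.
  The thresholds match: \<open>s = p ^ Suc k - 1\<close> gives \<open>s div p = p ^ k - 1\<close>,
  with equality there.\<close>

lemma pebble_bound_step:
  assumes "p > 1" "k < N"
  shows "pebble_bound p N (Suc k) s \<le> p ^ Suc k - p ^ k + pebble_bound p N k (s div p)"
proof -
  \<comment> \<open>The estimate is done over the integers, with truncated subtraction written as
    \<open>max 0\<close>; \<open>X\<close> and \<open>E\<close> make it polynomial.\<close>
  define q where "q = s div p"
  define X where "X = int (p ^ k)"
  define E where "E = int (p ^ (N - Suc k))"
  have X: "X \<ge> 1" and E: "E \<ge> 1"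
    using assms by (simp_all add: X_def E_def)
  have pE: "int (p ^ (N - k)) = int p * E"
    using assms by (simp add: E_def flip: power_Suc Suc_diff_Suc)
  have s: "int s \<le> int p * int q + int p - 1"
  proof -
    have "s mod p < p" using assms by simp
    moreover have "s = p * q + s mod p" by (simp add: q_def)
    ultimately have "s + 1 \<le> p * q + p" by linarith
    then have "int (s + 1) \<le> int (p * q + p)" by (simp only: of_nat_le_iff)
    then show ?thesis by simp
  qed
  have pos: "p ^ j \<ge> 1" for j
    using assms by simp
  have int_bound: "int (pebble_bound p N j t)
      = int t + (int (p ^ (N - j)) - 1) * max 0 (int t - (int (p ^ j) - 1))" for j t
  proof -
    have "int (p ^ i - 1) = int (p ^ i) - 1" for i
      using pos[of i] by (simp only: of_nat_diff of_nat_1)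
    moreover have "int (t - (p ^ j - 1)) = max 0 (int t - int (p ^ j - 1))"
      by simp
    ultimately show ?thesis
      by (simp only: pebble_bound_def of_nat_add of_nat_mult)
  qed
  have l: "int (pebble_bound p N (Suc k) s) = int s + (E - 1) * max 0 (int s - (int p * X - 1))"
    by (simp add: int_bound E_def X_def)
  have r: "int (pebble_bound p N k q) = int q + (int p * E - 1) * max 0 (int q - (X - 1))"
    by (simp only: int_bound pE X_def)
  have d: "int (p ^ Suc k - p ^ k) = int p * X - X"
    using pos[of k] assms by (simp add: X_def of_nat_diff)
  have le: "(E - 1) * max 0 (int s - (int p * X - 1)) \<le> (E - 1) * (int p * max 0 (int q - (X - 1)))"
  proof (rule mult_left_mono)
    have "int s - (int p * X - 1) \<le> int p * (int q - (X - 1))"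
      using s by (simp add: algebra_simps)
    also have "\<dots> \<le> int p * max 0 (int q - (X - 1))"
      by (rule mult_left_mono) auto
    finally show "max 0 (int s - (int p * X - 1)) \<le> int p * max 0 (int q - (X - 1))"
      by simp
  qed (use E in simp)
  \<comment> \<open>Cancelling the multiples of \<open>E\<close> leaves \<open>p - 1\<close> times
    the trivial bound of a number by its positive part.\<close>
  have "int p * int q + int p - 1 + (E - 1) * (int p * max 0 (int q - (X - 1)))
     \<le> int p * X - X + int q + (int p * E - 1) * max 0 (int q - (X - 1))"
  proof -
    have "(int p - 1) * (int q - (X - 1)) \<le> (int p - 1) * max 0 (int q - (X - 1))"
      using assms by (intro mult_left_mono) auto
    then show ?thesis
      by (simp add: algebra_simps)
  qed
  with l r d s le have "int (pebble_bound p N (Suc k) s)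
      \<le> int (p ^ Suc k - p ^ k + pebble_bound p N k q)"
    by (simp only: of_nat_add)
  then show ?thesis
    by (simp only: of_nat_le_iff q_def)
qed

section \<open>Pebbling towards the trivial subgroup\<close>

locale finite_abelian_p_group = comm_group +
  fixes p N :: nat
  assumes prime_p: "Factorial_Ring.prime p" and order_eq: "order G = p ^ N"
begin

lemma p_gt_1: "p > 1"
  using prime_p prime_gt_1_nat by blast

lemma finite_carrier: "finite (carrier G)"
  using order_eq p_gt_1 order_gt_0_iff_finite by force

lemma ord_prime_power:
  assumes "x \<in> carrier G"
  obtains a where "a \<le> N" "ord x = p ^ a"
  using ord_dvd_group_order[OF assms] order_eq divides_primepow_nat[OF prime_p] by metis

text \<open>In the tree these are the generators of the proper descendants of \<open>C\<close>, the
  budget against which terms are charged.\<close>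

definition above :: "'a set \<Rightarrow> 'a set" where
  "above C = {x \<in> carrier G. C \<subset> generate G {x}}"

lemma finite_above: "finite (above C)"
  using finite_carrier by (simp add: above_def)

text \<open>For \<open>x\<close> above a subgroup \<open>C\<close> of order \<open>p ^ k\<close>,
  \<open>layer (Suc k) x\<close> is the child of \<open>C\<close> on the path to
  \<open>generate G {x}\<close>.\<close>

definition layer :: "nat \<Rightarrow> 'a \<Rightarrow> 'a set" where
  "layer k x = {y \<in> generate G {x}. y [^] (p ^ k) = \<one>}"

lemma layer_above:
  assumes C: "subgroup C G" "card C = p ^ k" and x: "x \<in> above C"
  shows "subgroup (layer (Suc k) x) G" "card (layer (Suc k) x) = p ^ Suc k"
    "C \<subseteq> layer (Suc k) x" "layer (Suc k) x \<subseteq> generate G {x}"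
proof -
  have xG: "x \<in> carrier G" and sub: "C \<subset> generate G {x}"
    using x by (auto simp: above_def)
  obtain a where a: "ord x = p ^ a"
    using ord_prime_power[OF xG] by blast
  have fin: "finite (generate G {x})"
    using generate_incl[of "{x}"] xG finite_carrier finite_subset by blast
  have "p ^ k < p ^ a"
    using psubset_card_mono[OF fin sub] C generate_pow_card[OF xG] a by simp
  then have "Suc k \<le> a"
    using p_gt_1 by simp
  then show "subgroup (layer (Suc k) x) G" "card (layer (Suc k) x) = p ^ Suc k"
    unfolding layer_def by (rule subgroup_cyclic_prime_power[OF prime_p xG a])+
  show "layer (Suc k) x \<subseteq> generate G {x}"
    by (auto simp: layer_def)
  show "C \<subseteq> layer (Suc k) x"
  proof
    fix y assume y: "y \<in> C"
    then have "y [^] (p ^ k) = \<one>" "y \<in> carrier G"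
      using subgroup_pow_card_eq_one[OF C(1)] C(2) subgroup.mem_carrier[OF C(1)] by auto
    then have "ord y dvd p ^ k" by (simp add: pow_eq_id)
    then have "ord y dvd p ^ Suc k" by (simp add: dvd_mult)
    then have "y [^] (p ^ Suc k) = \<one>"
      using \<open>y \<in> carrier G\<close> by (simp only: pow_eq_id)
    then show "y \<in> layer (Suc k) x"
      using y sub by (auto simp: layer_def)
  qed
qed

text \<open>The fibre over the child \<open>D\<close> contains everything above \<open>D\<close>
  and, disjointly, the generators of \<open>D\<close>, which are the elements of
  \<open>D - C\<close>.\<close>

lemma card_layer_fibre:
  assumes C: "subgroup C G" "card C = p ^ k" and D: "D \<in> layer (Suc k) ` above C"
  shows "card (above D) + (p ^ Suc k - p ^ k) \<le> card {x \<in> above C. layer (Suc k) x = D}"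
proof -
  obtain x where x: "x \<in> above C" "D = layer (Suc k) x"
    using D by blast
  note D' = layer_above[OF C x(1), folded x(2)]
  have xG: "x \<in> carrier G" using x by (simp add: above_def)
  have DG: "D \<subseteq> carrier G"
    using D'(1) subgroup.subset by blast
  have finD: "finite D"
    using DG finite_carrier finite_subset by blast
  have "card C < card D"
    using C D'(2) p_gt_1 by simp
  then have CD: "C \<subset> D"
    using D'(3) by blast
  have mem: "y \<in> above C \<and> layer (Suc k) y = D" if y: "y \<in> carrier G" "D \<subseteq> generate G {y}" for y
  proof -
    obtain a where a: "ord y = p ^ a"
      using ord_prime_power[OF y(1)] by blast
    have "D = layer (Suc k) y"
      unfolding layer_def
      by (rule subgroup_cyclic_prime_power_unique(2)[OF prime_p y(1) a D'(1) y(2) D'(2)])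
    then show ?thesis
      using y CD by (auto simp: above_def)
  qed
  \<comment> \<open>\<open>C\<close> is the whole \<open>p ^ k\<close>-torsion of
    \<open>generate G {x}\<close>, so an element of \<open>D\<close> outside \<open>C\<close> has
    order exactly \<open>p ^ Suc k\<close>.\<close>
  have gen: "generate G {y} = D" if y: "y \<in> D - C" for y
  proof -
    have yG: "y \<in> carrier G" using y DG by blast
    obtain a where a: "ord x = p ^ a"
      using ord_prime_power[OF xG] by blast
    have "C = {y \<in> generate G {x}. y [^] (p ^ k) = \<one>}"
      by (rule subgroup_cyclic_prime_power_unique(2)[OF prime_p xG a C(1) _ C(2)])
        (use D' in auto)
    then have "y [^] (p ^ k) \<noteq> \<one>"
      using y D' by blast
    then have nd: "\<not> ord y dvd p ^ k"
      using yG by (simp add: pow_eq_id)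
    have "ord y dvd p ^ Suc k"
      using subgroup_pow_card_eq_one[OF D'(1), of y] y yG D'(2) by (simp only: pow_eq_id Diff_iff)
    then obtain i where i: "i \<le> Suc k" "ord y = p ^ i"
      using divides_primepow_nat[OF prime_p] by blast
    with nd have "i = Suc k"
      by (metis le_SucE le_imp_power_dvd)
    then have "card (generate G {y}) = card D"
      using i D'(2) generate_pow_card[OF yG] by simp
    moreover have "generate G {y} \<subseteq> D"
      using y by (intro generate_subgroup_incl D'(1)) auto
    ultimately show ?thesis
      using finD by (simp add: card_subset_eq)
  qed
  have "above D \<inter> (D - C) = {}"
    using gen by (auto simp: above_def)
  then have "card (above D \<union> (D - C)) = card (above D) + card (D - C)"
    using finite_above finD by (intro card_Un_disjoint) auto
  also have "card (D - C) = p ^ Suc k - p ^ k"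
    using C D' finD finite_subset[OF D'(3)] by (simp add: card_Diff_subset)
  finally have "card (above D) + (p ^ Suc k - p ^ k) = card (above D \<union> (D - C))" ..
  also have "\<dots> \<le> card {x \<in> above C. layer (Suc k) x = D}"
  proof (rule card_mono)
    show "above D \<union> (D - C) \<subseteq> {x \<in> above C. layer (Suc k) x = D}"
    proof
      fix y assume "y \<in> above D \<union> (D - C)"
      then have "y \<in> carrier G" "D \<subseteq> generate G {y}"
        using gen DG by (auto simp: above_def)
      then show "y \<in> {x \<in> above C. layer (Suc k) x = D}"
        using mem by simp
    qed
  qed (simp add: finite_above)
  finally show ?thesis .
qed

text \<open>Induction from the top order \<open>p ^ N\<close> down to the root. The inequality is a
  dichotomy: either there are few terms or many pebbles reach \<open>C\<close>. At the root,
  \<open>s = 0\<close> allows only \<open>card (above C)\<close> terms.\<close>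

lemma exists_packing:
  assumes "k \<le> N" "subgroup C G" "card C = p ^ k"
    and "finite I" "\<And>i. i \<in> I \<Longrightarrow> g i \<in> carrier G \<and> C \<subseteq> generate G {g i}"
  shows "\<exists>s. packs g C I s \<and> card I \<le> card (above C) + pebble_bound p N k s"
  using assms
proof (induction k arbitrary: C I rule: inc_induct)
  case base
  \<comment> \<open>Here \<open>C\<close> has the order of the whole group, so every term generates
    \<open>C\<close> and is already a pebble on it.\<close>
  have "generate G {g i} = C" if "i \<in> I" for i
  proof (rule sym, rule card_seteq)
    have gi: "g i \<in> carrier G" using base(4) that by blast
    show "finite (generate G {g i})"
      using generate_incl[of "{g i}"] gi finite_carrier finite_subset by blast
    show "card (generate G {g i}) \<le> card C"
      using ord_le_group_order[OF finite_carrier gi] generate_pow_card[OF gi] order_eq base by simp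
    show "C \<subseteq> generate G {g i}" using base(4) that by blast
  qed
  then have "packs g C I (card I)"
    using base by (intro packs_singletons) auto
  then show ?case
    using pebble_bound_ge[of "card I" p N N] by (meson trans_le_add2)
next
  case (step k)
  note C = step.prems(1,2)
  \<comment> \<open>Terms generating \<open>C\<close> are pebbles on \<open>C\<close>; the others
    are sorted by the child of \<open>C\<close> that their cyclic subgroup contains.\<close>
  define I0 where "I0 = {i \<in> I. generate G {g i} = C}"
  define I1 where "I1 = {i \<in> I. g i \<in> above C}"
  define L where "L = layer (Suc k)"
  define \<D> where "\<D> = L ` above C"
  define J where "J D = {i \<in> I1. L (g i) = D}" for D
  have fin: "finite I0" "finite I1" "finite \<D>" "\<And>D. finite (J D)"
    using step.prems(3) finite_above by (auto simp: I0_def I1_def \<D>_def J_def)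
  have I: "I = I0 \<union> I1" "I0 \<inter> I1 = {}"
    using step.prems(4) by (auto simp: I0_def I1_def above_def)
  have I1_UN: "I1 = (\<Union>D\<in>\<D>. J D)"
    by (auto simp: I1_def \<D>_def J_def)
  have g: "g i \<in> carrier G" if "i \<in> I" for i
    using step.prems(4) that by blast
  have D: "subgroup D G" "card D = p ^ Suc k" "C \<subseteq> D" if "D \<in> \<D>" for D
    using that layer_above[OF C] by (auto simp: \<D>_def L_def)
  have "\<exists>s. packs g D (J D) s \<and> card (J D) \<le> card (above D) + pebble_bound p N (Suc k) s"
    if "D \<in> \<D>" for D
  proof (rule step.IH)
    show "g i \<in> carrier G \<and> D \<subseteq> generate G {g i}" if "i \<in> J D" for i
      using that by (auto simp: J_def I1_def L_def layer_def above_def)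
  qed (use D[OF that] fin in auto)
  then obtain s where s: "\<And>D. D \<in> \<D> \<Longrightarrow> packs g D (J D) (s D)"
    "\<And>D. D \<in> \<D> \<Longrightarrow> card (J D) \<le> card (above D) + pebble_bound p N (Suc k) (s D)"
    by metis
  have "packs g C (J D) (s D div p)" if "D \<in> \<D>" for D
  proof (rule packs_subgroup_step[OF C(1) D(1)[OF that] D(3)[OF that]])
    show "finite D"
      using D(2)[OF that] p_gt_1 by (intro card_ge_0_finite) simp
    show "g \<in> J D \<rightarrow> carrier G"
      using g by (auto simp: J_def I1_def)
  qed (use D[OF that] C fin s that in auto)
  moreover have "disjoint_family_on J \<D>"
    by (auto simp: disjoint_family_on_def J_def)
  ultimately have "packs g C I1 (\<Sum>D\<in>\<D>. s D div p)"
    unfolding I1_UN by (intro packs_UN fin)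
  moreover have "packs g C I0 (card I0)"
    by (rule packs_singletons) (use fin g in \<open>auto simp: I0_def\<close>)
  ultimately have "packs g C I (card I0 + (\<Sum>D\<in>\<D>. s D div p))"
    unfolding I(1) by (intro packs_Un I(2))
  \<comment> \<open>In each fibre the generators of \<open>D\<close> pay for what the division by
    \<open>p\<close> loses; superadditivity then collects the children and the terms in
    \<open>I0\<close> into one bound.\<close>
  moreover have "card I \<le> card (above C) + pebble_bound p N k (card I0 + (\<Sum>D\<in>\<D>. s D div p))"
  proof -
    have "card I1 = (\<Sum>D\<in>\<D>. card (J D))"
      unfolding J_def card_eq_sum by (rule sum.group[symmetric]) (use fin in \<open>auto simp: I1_def \<D>_def\<close>)
    also have "\<dots> \<le> (\<Sum>D\<in>\<D>. card {x \<in> above C. L x = D} + pebble_bound p N k (s D div p))"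
    proof (rule sum_mono)
      fix D assume D: "D \<in> \<D>"
      show "card (J D) \<le> card {x \<in> above C. L x = D} + pebble_bound p N k (s D div p)"
        using s(2)[OF D] pebble_bound_step[OF p_gt_1 \<open>k < N\<close>, of "s D"]
          card_layer_fibre[OF C D[unfolded \<D>_def L_def], folded L_def] by linarith
    qed
    also have "\<dots> = card (above C) + (\<Sum>D\<in>\<D>. pebble_bound p N k (s D div p))"
    proof -
      have "(\<Sum>D\<in>\<D>. card {x \<in> above C. L x = D}) = card (above C)"
        unfolding card_eq_sum by (rule sum.group) (use fin finite_above in \<open>auto simp: \<D>_def\<close>)
      then show ?thesis by (simp add: sum.distrib)
    qed
    also have "\<dots> \<le> card (above C) + pebble_bound p N k (\<Sum>D\<in>\<D>. s D div p)"
      using pebble_bound_sum[OF fin(3)] by simp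
    finally have "card I1 \<le> card (above C) + pebble_bound p N k (\<Sum>D\<in>\<D>. s D div p)" .
    moreover have "card I = card I0 + card I1"
      using I fin by (simp add: card_Un_disjoint)
    ultimately show ?thesis
      using pebble_bound_ge[of "card I0" p N k]
        pebble_bound_superadditive[of p N k "card I0" "\<Sum>D\<in>\<D>. s D div p"] by linarith
  qed
  ultimately show ?case
    by blast
qed

text \<open>A pebble on the trivial subgroup is a block with product \<open>\<one>\<close> and cross
  number at most 1, so it suffices that one reaches the root.\<close>

theorem exists_zero_sum_cross_number_le_1:
  assumes "finite I" "order G \<le> card I" "g \<in> I \<rightarrow> carrier G"
  shows "\<exists>K. K \<noteq> {} \<and> K \<subseteq> I \<and> finprod G g K = \<one> \<and> (\<Sum>k\<in>K. 1 / real (ord (g k))) \<le> 1"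
proof -
  have "subgroup {\<one>} G"
    by (rule triv_subgroup)
  moreover have "g i \<in> carrier G \<and> {\<one>} \<subseteq> generate G {g i}" if "i \<in> I" for i
    using assms(3) that generate.one by auto
  ultimately obtain s where s: "packs g {\<one>} I s"
    "card I \<le> card (above {\<one>}) + pebble_bound p N 0 s"
    using exists_packing[of 0 "{\<one>}" I g] assms(1) by auto
  \<comment> \<open>The identity is missing from \<open>above {\<one>}\<close>; this is why
    \<open>order G\<close> terms exceed the budget.\<close>
  have "\<one> \<notin> above {\<one>}"
    using generate_one by (simp add: above_def)
  then have "above {\<one>} \<subset> carrier G"
    unfolding above_def by blast
  then have "card (above {\<one>}) < card I"
    using psubset_card_mono[OF finite_carrier, of "above {\<one>}"] assms(2)
    unfolding order_def by linarith
  with s(2) have "s \<noteq> 0"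
    by (cases s) (auto simp: pebble_bound_def)
  moreover obtain P where P: "card P = s" "\<forall>K\<in>P. K \<noteq> {} \<and> K \<subseteq> I \<and> finprod G g K \<in> {\<one>} \<and>
        (\<Sum>k\<in>K. 1 / real (ord (g k))) \<le> 1 / real (card {\<one>})"
    using s(1) unfolding packs_def by blast
  ultimately obtain K where "K \<in> P"
    by fastforce
  with P(2) show ?thesis
    by (intro exI[of _ K]) auto
qed

end

section \<open>Direct sums of cyclic groups\<close>

lemma order_sum_group:
  assumes "finite I" "\<And>i. i \<in> I \<Longrightarrow> group (H i)"
  shows "order (sum_group I H) = (\<Prod>i\<in>I. order (H i))"
proof -
  have "carrier (sum_group I H) = (\<Pi>\<^sub>E i\<in>I. carrier (H i))"
    using assms by (simp add: carrier_sum_group)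
  then show ?thesis
    using assms(1) by (simp add: order_def card_PiE)
qed

lemma comm_group_sum_group:
  assumes "\<And>i. i \<in> I \<Longrightarrow> comm_group (H i)"
  shows "comm_group (sum_group I H)"
proof (rule group.group_comm_groupI)
  have grp: "group (H i)" if "i \<in> I" for i
    using assms[OF that] by (rule comm_group.axioms(2))
  then show "group (sum_group I H)"
    by simp
  fix x y assume "x \<in> carrier (sum_group I H)" "y \<in> carrier (sum_group I H)"
  then have "x i \<in> carrier (H i)" "y i \<in> carrier (H i)" if "i \<in> I" for i
    using that grp by (auto simp: carrier_sum_group)
  then show "x \<otimes>\<^bsub>sum_group I H\<^esub> y = y \<otimes>\<^bsub>sum_group I H\<^esub> x"
    using assms by (auto intro!: restrict_ext comm_monoid.m_comm comm_group.axioms(1))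
qed

theorem theorem5:
  fixes p m :: nat and e :: "nat \<Rightarrow> nat" and G :: "(nat \<Rightarrow> int) monoid"
  assumes "Factorial_Ring.prime p"
    and "m \<ge> 1"
    and "antimono_on {1..m} e"
    and "\<forall>j\<in>{1..m}. e j \<ge> 1"
    and "G = sum_group {1..m} (\<lambda>j. integer_mod_group (p ^ e j))"
  shows "order G = (\<Prod>j=1..m. p ^ e j) \<and>
    (\<forall>g \<in> {1..order G} \<rightarrow> carrier G.
       \<exists>K. K \<noteq> {} \<and> K \<subseteq> {1..order G} \<and>
           finprod G g K = \<one>\<^bsub>G\<^esub> \<and>
           (\<Sum>k\<in>K. 1 / real (group.ord G (g k))) \<le> 1)"
proof
  have "p > 0"
    using assms(1) prime_gt_0_nat by blast
  then have "order (integer_mod_group (p ^ e j)) = p ^ e j" for j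
    by (simp add: order_def carrier_integer_mod_group flip: of_nat_power)
  then show ord: "order G = (\<Prod>j=1..m. p ^ e j)"
    by (simp add: assms(5) order_sum_group)
  interpret comm_group G
    unfolding assms(5) by (rule comm_group_sum_group) simp
  interpret finite_abelian_p_group G p "\<Sum>j=1..m. e j"
    by unfold_locales (simp_all add: assms(1) ord power_sum)
  show "\<forall>g \<in> {1..order G} \<rightarrow> carrier G.
       \<exists>K. K \<noteq> {} \<and> K \<subseteq> {1..order G} \<and>
           finprod G g K = \<one>\<^bsub>G\<^esub> \<and>
           (\<Sum>k\<in>K. 1 / real (group.ord G (g k))) \<le> 1"
    by (intro ballI exists_zero_sum_cross_number_le_1) auto
qed

end
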